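(* Let $G=(Q,\Sigma,\delta,I)$ be a discrete-event system with $\Sigma=\Sigma_o\cup\Sigma_{uo}$, let $Q_S,Q_{NS}\subseteq Q$, let $P\colon\Sigma^*\to\Sigma_o^*$ be the projection, and let $K\in\mathbb{N}\cup\{\infty\}$. Then $G$ is $K$-step opaque with respect to $Q_S$, $Q_{NS}$, and $P$ if and only if Algorithm 1 (described in the context), run on the input $G,Q_S,Q_{NS},\Sigma_o,K$, returns true.
   Context: An NFA over a finite nonempty alphabet $\Sigma$ is $(Q,\Sigma,\delta,I,F)$ with finite state set $Q$, initial states $I\subseteq Q$, marked states $F\subseteq Q$ (omitted if irrelevant), and $\delta\colon Q\times\Sigma\to 2^Q$, extended in the usual way to $2^Q\times\Sigma^*$; for $S\subseteq\Sigma^*$, $\delta(X,S)=\bigcup_{s\in S}\delta(X,s)$. $L(G)=\{w\mid\delta(I,w)\ne\emptyset\}$ is the generated language. A discrete-event system (DES) is an NFA together with a partition of $\Sigma$ into observable events $\Sigma_o$ and unobservable events $\Sigma_{uo}$. The projection $P\colon\Sigma^*\to\Sigma_o^*$ is the morphism erasing the unobservable events. $K$-step opacity: $G$ is $K$-step opaque w.r.t. secret states $Q_S\subseteq Q$, non-secret states $Q_{NS}\subseteq Q$, and $P$ if for every $st\in L(G)$ with $|P(t)|\le K$ and $\delta(\delta(I,s)\cap Q_S,t)\neq\emptyset$, there is $s't'\in L(G)$ such that $P(s)=P(s')$, $P(t)=P(t')$, and $\delta(\delta(I,s')\cap Q_{NS},t')\neq\emptyset$. Projected automaton $P(G)$: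 the NFA over $\Sigma_o$ with states $Q$ and transition function $\gamma(q,a)=\delta(q,P^{-1}(a))$ for $a\in\Sigma_o$. Observer $G^{obs}$: the deterministic automaton obtained by the subset construction; its states are subsets of $Q$ (including $\emptyset$, and non-reachable subsets are also used when needed), its initial state is $\delta(I,P^{-1}(\varepsilon))$, and its transition under $a\in\Sigma_o$ takes $X$ to $\bigcup_{x\in X}\gamma(x,a)$. A reachable state of $G^{obs}$ is thus a set $\delta(I,P^{-1}P(s))$ for some $s\in L(G)$. Algorithm 1: (1) Set $Y:=\emptyset$. (2) Compute $G^{obs}$. (3) Compute $P(G)$. (4)-(6) For every reachable state $X$ of $G^{obs}$ and every $x\in X\cap Q_S$, add the pair $(x,X\cap Q_{NS})$ to $Y$. (7) Compute the product automaton $\mathcal{C}=P(G)\times G^{obs}$, whose states are pairs $(q,Z)$ with $q\in Q$, $Z\subseteq Q$, with a transition from $(q,Z)$ to $(q',Z')$ under $a\in\Sigma_o$ iff $q'\in\gamma(q,a)$ and $Z'=\bigcup_{z\in Z}\gamma(z,a)$, with the states of $Y$ as initial states. (8) Use breadth-first search to mark all states of $\mathcal{C}$ reachable from $Y$ in at most $K$ steps (in any number of steps if $K=\infty$). (9) If $\mathcal{C}$ contains a marked state of the form $(q,\emptyset)$, return false; otherwise return true. *)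

theory Defs
  imports Main "HOL-Library.Extended_Nat" "HOL-Library.While_Combinator"
begin

record ('q, 'a) nfa =
  states :: "'q set"
  alphabet :: "'a set"
  delta :: "'q \<Rightarrow> 'a \<Rightarrow> 'q set"
  initial :: "'q set"

definition is_nfa :: "('q, 'a) nfa \<Rightarrow> bool" where
  "is_nfa G \<longleftrightarrow>
     finite (states G) \<and> finite (alphabet G) \<and> alphabet G \<noteq> {} \<and>
     initial G \<subseteq> states G \<and>
     (\<forall>q \<in> states G. \<forall>a \<in> alphabet G. delta G q a \<subseteq> states G)"

text \<open>Either block of the partition into observable and unobservable events may be empty.\<close>

definition is_des :: "('q, 'a) nfa \<Rightarrow> 'a set \<Rightarrow> 'a set \<Rightarrow> bool" where
  "is_des G So Suo \<longleftrightarrow>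
     is_nfa G \<and> alphabet G = So \<union> Suo \<and> So \<inter> Suo = {}"

definition delta_star :: "('q, 'a) nfa \<Rightarrow> 'q set \<Rightarrow> 'a list \<Rightarrow> 'q set" where
  "delta_star G X w = foldl (\<lambda>Y a. \<Union>q\<in>Y. delta G q a) X w"

definition delta_lang :: "('q, 'a) nfa \<Rightarrow> 'q set \<Rightarrow> 'a list set \<Rightarrow> 'q set" where
  "delta_lang G X S = (\<Union>w\<in>S. delta_star G X w)"

definition gen_lang :: "('q, 'a) nfa \<Rightarrow> 'a list set" where
  "gen_lang G = {w \<in> lists (alphabet G). delta_star G (initial G) w \<noteq> {}}"

definition proj :: "'a set \<Rightarrow> 'a list \<Rightarrow> 'a list" where
  "proj So w = filter (\<lambda>a. a \<in> So) w"

definition inv_proj :: "('q, 'a) nfa \<Rightarrow> 'a set \<Rightarrow> 'a list \<Rightarrow> 'a list set" where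
  "inv_proj G So u = {w \<in> lists (alphabet G). proj So w = u}"

definition k_step_opaque ::
  "('q, 'a) nfa \<Rightarrow> 'q set \<Rightarrow> 'q set \<Rightarrow> 'a set \<Rightarrow> enat \<Rightarrow> bool" where
  "k_step_opaque G QS QNS So K \<longleftrightarrow>
     (\<forall>s t. s @ t \<in> gen_lang G \<and> enat (length (proj So t)) \<le> K \<and>
        delta_star G (delta_star G (initial G) s \<inter> QS) t \<noteq> {} \<longrightarrow>
        (\<exists>s' t'. s' @ t' \<in> gen_lang G \<and> proj So s = proj So s' \<and> proj So t = proj So t' \<and>
           delta_star G (delta_star G (initial G) s' \<inter> QNS) t' \<noteq> {}))"

text \<open>The initial states chosen for the projected automaton play no role in the algorithm
  below: the product automaton is started from its own set of initial states.\<close>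

definition projected :: "('q, 'a) nfa \<Rightarrow> 'a set \<Rightarrow> ('q, 'a) nfa" where
  "projected G So =
     \<lparr>states = states G, alphabet = So,
      delta = (\<lambda>q a. delta_lang G {q} (inv_proj G So [a])),
      initial = initial G\<rparr>"

record ('s, 'a) dfa =
  dstates :: "'s set"
  dalphabet :: "'a set"
  dtrans :: "'s \<Rightarrow> 'a \<Rightarrow> 's"
  dinitial :: 's

text \<open>The state set consists of all subsets, reachable or not; the transition function is total,
  with the empty set as a sink.\<close>

definition observer :: "('q, 'a) nfa \<Rightarrow> 'a set \<Rightarrow> ('q set, 'a) dfa" where
  "observer G So =
     \<lparr>dstates = Pow (states G), dalphabet = So,
      dtrans = (\<lambda>X a. \<Union>x\<in>X. delta (projected G So) x a),
      dinitial = delta_lang G (initial G) (inv_proj G So [])\<rparr>"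

definition dreachable :: "('s, 'a) dfa \<Rightarrow> 's set" where
  "dreachable D = {foldl (dtrans D) (dinitial D) u | u. u \<in> lists (dalphabet D)}"

definition product ::
  "('q, 'a) nfa \<Rightarrow> ('s, 'a) dfa \<Rightarrow> ('q \<times> 's) set \<Rightarrow> ('q \<times> 's, 'a) nfa" where
  "product A D Y =
     \<lparr>states = states A \<times> dstates D, alphabet = alphabet A \<inter> dalphabet D,
      delta = (\<lambda>(q, Z) a. {(q', Z'). q' \<in> delta A q a \<and> Z' = dtrans D Z a}),
      initial = Y\<rparr>"

definition successors :: "('q, 'a) nfa \<Rightarrow> 'q set \<Rightarrow> 'q set" where
  "successors A X = (\<Union>q\<in>X. \<Union>a\<in>alphabet A. delta A q a)"

text \<open>Layered breadth-first search of depth at most \<open>K\<close> from the initial states. The loop state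
  \<open>(M, F, k)\<close> holds the marked states, those newly marked in the last round, and the number of
  rounds; the result is \<open>None\<close> if the loop does not terminate.\<close>

definition bfs :: "('q, 'a) nfa \<Rightarrow> enat \<Rightarrow> 'q set option" where
  "bfs A K = map_option fst
     (while_option
        (\<lambda>(M, F, k). F \<noteq> {} \<and> enat k < K)
        (\<lambda>(M, F, k). let F' = successors A F - M in (M \<union> F', F', Suc k))
        (initial A, initial A, 0))"

definition opacity_algorithm ::
  "('q, 'a) nfa \<Rightarrow> 'q set \<Rightarrow> 'q set \<Rightarrow> 'a set \<Rightarrow> enat \<Rightarrow> bool option" where
  "opacity_algorithm G QS QNS So K =
     (let Gobs = observer G So;
          PG = projected G So;
          Y = (\<Union>X\<in>dreachable Gobs. {(x, X \<inter> QNS) | x. x \<in> X \<inter> QS});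
          C = product PG Gobs Y
      in map_option (\<lambda>M. \<not> (\<exists>q. (q, {}) \<in> M)) (bfs C K))"

end

theory Submission
  imports Defs
begin

text \<open>For observations \<open>u\<close> and \<open>v\<close>, let \<open>X\<close> be the set of states reachable under \<open>u\<close>. All non-secret
  continuations of \<open>u\<close> by \<open>v\<close> die out iff the observer, started in \<open>X \<inter> QNS\<close>, reaches \<open>{}\<close> under
  \<open>v\<close>, and some secret continuation survives iff the projected automaton has a run on \<open>v\<close> from
  some \<open>x \<in> X \<inter> QS\<close>. Hence opacity fails iff the product automaton reaches some \<open>(q, {})\<close> from
  some \<open>(x, X \<inter> QNS)\<close> in \<open>length v \<le> K\<close> steps.\<close>

section \<open>Breadth-first search\<close>

lemma successors_mono: "X \<subseteq> Y \<Longrightarrow> successors A X \<subseteq> successors A Y"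
  by (auto simp: successors_def)

lemma successors_Un: "successors A (X \<union> Y) = successors A X \<union> successors A Y"
  by (auto simp: successors_def)

lemma successors_UN: "successors A (\<Union>i\<in>I. X i) = (\<Union>i\<in>I. successors A (X i))"
  by (auto simp: successors_def)

definition reach_within :: "('q, 'a) nfa \<Rightarrow> enat \<Rightarrow> 'q set" where
  "reach_within A K = (\<Union>j\<in>{j. enat j \<le> K}. (successors A ^^ j) (initial A))"

lemma reach_within_0: "reach_within A 0 = initial A"
proof -
  have "{j. enat j \<le> 0} = {0}"
    by (auto simp: zero_enat_def)
  then show ?thesis by (simp add: reach_within_def)
qed

lemma initial_subset_reach_within: "initial A \<subseteq> reach_within A K"
proof -
  have "(successors A ^^ 0) (initial A) \<subseteq> reach_within A K"
    unfolding reach_within_def by (rule UN_upper) (simp add: zero_enat_def[symmetric])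
  then show ?thesis by simp
qed

text \<open>Applying \<open>successors\<close> shifts the step index by one, so only the layer of
  index 0 is left over, and it already lies in the smaller set.\<close>

lemma reach_within_Suc:
  "reach_within A (enat (Suc k)) = reach_within A (enat k) \<union> successors A (reach_within A (enat k))"
proof -
  have "reach_within A (enat (Suc k)) = (\<Union>j\<in>{..Suc k}. (successors A ^^ j) (initial A))"
    by (simp add: reach_within_def atMost_def)
  also have "\<dots> = initial A \<union> (\<Union>j\<in>{..k}. (successors A ^^ Suc j) (initial A))"
    by (simp add: atMost_Suc_eq_insert_0 image_comp)
  also have "(\<Union>j\<in>{..k}. (successors A ^^ Suc j) (initial A)) =
      successors A (reach_within A (enat k))"
    by (simp add: reach_within_def successors_UN atMost_def)
  finally have "reach_within A (enat (Suc k)) =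
      initial A \<union> successors A (reach_within A (enat k))" .
  moreover have "initial A \<subseteq> reach_within A (enat k)"
    by (rule initial_subset_reach_within)
  moreover have "reach_within A (enat k) \<subseteq> reach_within A (enat (Suc k))"
    by (auto simp: reach_within_def intro: le_SucI)
  ultimately show ?thesis by blast
qed

text \<open>Justifies stopping as soon as a round finds nothing new; this is the only way the search
  ends when \<open>K\<close> is \<infinity>.\<close>

lemma reach_within_closed:
  assumes "successors A (reach_within A (enat k)) \<subseteq> reach_within A (enat k)" "enat k \<le> K"
  shows "reach_within A K = reach_within A (enat k)"
proof
  have "(successors A ^^ j) (initial A) \<subseteq> reach_within A (enat k)" for j
  proof (induction j)
    case 0
    show ?case
      by (simp add: initial_subset_reach_within)
  next
    case (Suc j)
    then show ?case
      using assms(1) successors_mono[OF Suc.IH] by auto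
  qed
  then show "reach_within A K \<subseteq> reach_within A (enat k)"
    by (auto simp: reach_within_def)
  show "reach_within A (enat k) \<subseteq> reach_within A K"
    using assms(2) order_trans unfolding reach_within_def by blast
qed

text \<open>Each round either marks a new element of the finite set \<open>S\<close> or empties the
  frontier, so the loop terminates for every \<open>K\<close>.\<close>

lemma bfs_eq_reach_within:
  assumes fin: "finite S" and init: "initial A \<subseteq> S" and closed: "successors A S \<subseteq> S"
  shows "bfs A K = Some (reach_within A K)"
proof -
  define b :: "'a set \<times> 'a set \<times> nat \<Rightarrow> bool"
    where "b = (\<lambda>(M, F, k). F \<noteq> {} \<and> enat k < K)"
  define c :: "'a set \<times> 'a set \<times> nat \<Rightarrow> 'a set \<times> 'a set \<times> nat"
    where "c = (\<lambda>(M, F, k). let F' = successors A F - M in (M \<union> F', F', Suc k))"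
  \<comment> \<open>The last conjunct says that only the frontier \<open>F\<close> can have
    successors outside \<open>M\<close>; it is what allows a round to expand \<open>F\<close>
    instead of all of \<open>M\<close>.\<close>
  define P :: "'a set \<times> 'a set \<times> nat \<Rightarrow> bool"
    where "P = (\<lambda>(M, F, k). M \<subseteq> S \<and> F \<subseteq> M \<and> enat k \<le> K \<and> M = reach_within A (enat k) \<and>
                 successors A M \<subseteq> M \<union> successors A F)"
  \<comment> \<open>The second summand accounts for the last round, in which nothing new is marked.\<close>
  define m :: "'a set \<times> 'a set \<times> nat \<Rightarrow> nat"
    where "m = (\<lambda>(M, F, k). card (S - M) + (if F = {} then 0 else 1))"
  let ?s = "(initial A, initial A, 0)"
  have P_init: "P ?s"
    using init by (auto simp: P_def reach_within_0 zero_enat_def[symmetric])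
  have P_step: "P (c s)" if "P s" "b s" for s
  proof -
    obtain M F k where s: "s = (M, F, k)" by (cases s)
    from that have *: "M \<subseteq> S" "F \<subseteq> M" "enat k < K" "M = reach_within A (enat k)"
        "successors A M \<subseteq> M \<union> successors A F"
      by (auto simp: s P_def b_def)
    have FM: "successors A F \<subseteq> successors A M" and MS: "successors A M \<subseteq> S"
      using successors_mono *(1,2) closed by blast+
    have "M \<union> (successors A F - M) = reach_within A (enat (Suc k))"
      using FM *(4,5) by (auto simp: reach_within_Suc)
    moreover have "successors A (M \<union> (successors A F - M)) \<subseteq>
        (M \<union> (successors A F - M)) \<union> successors A (successors A F - M)"
      using *(5) unfolding successors_Un by blast
    moreover have "enat (Suc k) \<le> K"
      using *(3) by (simp add: Suc_ile_eq)
    moreover have "M \<union> (successors A F - M) \<subseteq> S"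
      using *(1) FM MS by blast
    ultimately show ?thesis
      by (simp add: s P_def c_def Let_def) blast
  qed
  have m_step: "m (c s) < m s" if "P s" "b s" for s
  proof -
    obtain M F k where s: "s = (M, F, k)" by (cases s)
    from that have *: "M \<subseteq> S" "F \<subseteq> M" "F \<noteq> {}"
      by (auto simp: s P_def b_def)
    show ?thesis
    proof (cases "successors A F - M = {}")
      case True
      then have "M \<union> successors A F = M" by blast
      with True show ?thesis using * by (simp add: s m_def c_def)
    next
      case False
      have "successors A F \<subseteq> S"
        using successors_mono[of F S A] * closed by blast
      then have "S - (M \<union> (successors A F - M)) \<subset> S - M"
        using False by blast
      then have "card (S - (M \<union> (successors A F - M))) < card (S - M)"
        using fin by (intro psubset_card_mono) auto
      then show ?thesis using False * by (simp add: s m_def c_def Let_def)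
    qed
  qed
  obtain t where t: "while_option b c ?s = Some t"
    using measure_while_option_Some[of P b c m ?s] P_init P_step m_step by blast
  obtain M F k where tt: "t = (M, F, k)" by (cases t)
  have "P t"
    using while_option_rule[OF _ t, of P] P_init P_step by blast
  moreover have "\<not> b t"
    using while_option_stop[OF t] .
  ultimately have *: "enat k \<le> K" "M = reach_within A (enat k)"
      "successors A M \<subseteq> M \<union> successors A F" "F = {} \<or> \<not> enat k < K"
    by (auto simp: P_def b_def tt)
  \<comment> \<open>The loop stops for one of two reasons: an empty frontier makes \<open>M\<close>
    closed under successors, and otherwise the counter \<open>k\<close> equals
    \<open>K\<close>.\<close>
  have "reach_within A K = M"
  proof (cases "F = {}")
    case True
    then have "successors A M \<subseteq> M"
      using *(3) by (auto simp: successors_def)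
    then show ?thesis using reach_within_closed *(1,2) by blast
  next
    case False
    then have "K = enat k" using *(1,4) by auto
    then show ?thesis using *(2) by simp
  qed
  then show ?thesis
    using t by (simp add: bfs_def b_def c_def tt)
qed

section \<open>Extended transition functions\<close>

lemma delta_star_Nil [simp]: "delta_star G X [] = X"
  by (simp add: delta_star_def)

lemma delta_star_Cons: "delta_star G X (a # w) = delta_star G (\<Union>q\<in>X. delta G q a) w"
  by (simp add: delta_star_def)

lemma delta_star_append: "delta_star G X (v @ w) = delta_star G (delta_star G X v) w"
  by (simp add: delta_star_def)

lemma delta_star_UN: "delta_star G (\<Union>i\<in>I. X i) w = (\<Union>i\<in>I. delta_star G (X i) w)"
proof (induction w arbitrary: X)
  case (Cons a w)
  have "(\<Union>q\<in>(\<Union>i\<in>I. X i). delta G q a) = (\<Union>i\<in>I. \<Union>q\<in>X i. delta G q a)"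
    by blast
  then show ?case
    using Cons.IH[of "\<lambda>i. \<Union>q\<in>X i. delta G q a"] by (simp only: delta_star_Cons)
qed simp

lemma delta_star_empty [simp]: "delta_star G {} w = {}"
  using delta_star_UN[of G "\<lambda>x. x" "{}" w] by simp

lemma delta_star_mono: "X \<subseteq> Y \<Longrightarrow> delta_star G X w \<subseteq> delta_star G Y w"
proof (induction w arbitrary: X Y)
  case (Cons a w)
  then have "(\<Union>q\<in>X. delta G q a) \<subseteq> (\<Union>q\<in>Y. delta G q a)" by blast
  then show ?case by (simp add: delta_star_Cons Cons.IH)
qed simp

lemma delta_lang_UN: "delta_lang G (\<Union>i\<in>I. X i) S = (\<Union>i\<in>I. delta_lang G (X i) S)"
  by (auto simp: delta_lang_def delta_star_UN)

lemma delta_star_subset_states: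
  assumes "is_nfa G" "X \<subseteq> states G" "w \<in> lists (alphabet G)"
  shows "delta_star G X w \<subseteq> states G"
  using assms(2,3)
proof (induction w arbitrary: X)
  case (Cons a w)
  then have "(\<Union>q\<in>X. delta G q a) \<subseteq> states G"
    using assms(1) by (simp add: is_nfa_def) blast
  then show ?case using Cons by (simp add: delta_star_Cons)
qed simp

lemma delta_lang_inv_proj_subset_states:
  "is_nfa G \<Longrightarrow> X \<subseteq> states G \<Longrightarrow> delta_lang G X (inv_proj G So u) \<subseteq> states G"
  unfolding delta_lang_def inv_proj_def
  by (intro UN_least delta_star_subset_states) simp_all

section \<open>Projections of words and their preimages\<close>

lemma proj_append [simp]: "proj So (v @ w) = proj So v @ proj So w"
  by (simp add: proj_def)

text \<open>Each letter of \<open>u\<close> moves one observable event of \<open>w\<close>, with the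
  unobservable events before it, into \<open>s\<close>. Once \<open>u\<close> is used up, the whole
  rest goes to \<open>t\<close>.\<close>

lemma proj_eq_appendE:
  assumes "proj So w = u @ v"
  obtains s t where "w = s @ t" "proj So s = u" "proj So t = v"
  using assms
proof (induction u arbitrary: w thesis)
  case Nil
  then show ?case by (metis append_Nil filter.simps(1) proj_def)
next
  case (Cons a u)
  from Cons.prems(2) obtain xs ys where w: "w = xs @ a # ys" "\<forall>x\<in>set xs. x \<notin> So" "a \<in> So"
      "proj So ys = u @ v"
    by (auto simp: proj_def filter_eq_Cons_iff)
  from Cons.IH[OF _ w(4)] obtain s t where "ys = s @ t" "proj So s = u" "proj So t = v" by blast
  with w show ?case
    by (intro Cons.prems(1)[of "xs @ a # s" t]) (auto simp: proj_def filter_empty_conv)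
qed

lemma inv_proj_append:
  "inv_proj G So (u @ v) = {s @ t | s t. s \<in> inv_proj G So u \<and> t \<in> inv_proj G So v}"
  by (auto simp: inv_proj_def elim!: proj_eq_appendE) blast

lemma delta_lang_inv_proj_append:
  "delta_lang G X (inv_proj G So (u @ v)) =
   delta_lang G (delta_lang G X (inv_proj G So u)) (inv_proj G So v)"
proof -
  have "delta_lang G X (inv_proj G So (u @ v)) =
      (\<Union>s\<in>inv_proj G So u. \<Union>t\<in>inv_proj G So v. delta_star G X (s @ t))"
    unfolding delta_lang_def inv_proj_append by blast
  then show ?thesis
    by (auto simp: delta_lang_def delta_star_append delta_star_UN)
qed

section \<open>Projected automaton and observer\<close>

lemma Union_delta_projected:
  "(\<Union>q\<in>X. delta (projected G So) q a) = delta_lang G X (inv_proj G So [a])"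
  using delta_lang_UN[of G "\<lambda>x. {x}" X] by (simp add: projected_def)

text \<open>The start set is already closed under unobservable moves, so equality holds even for
  empty \<open>v\<close>. Keeping \<open>u\<close> arbitrary lets the induction move the letters of
  \<open>v\<close> one by one to the end of \<open>u\<close>.\<close>

lemma delta_star_projected:
  "delta_star (projected G So) (delta_lang G X (inv_proj G So u)) v =
   delta_lang G X (inv_proj G So (u @ v))"
proof (induction v arbitrary: u)
  case (Cons a v)
  show ?case
    using Cons.IH[of "u @ [a]"]
    by (simp add: delta_star_Cons Union_delta_projected flip: delta_lang_inv_proj_append)
qed simp

text \<open>For \<open>u = []\<close> the two sets themselves may differ: the projected automaton does not move,
  whereas \<open>G\<close> may perform unobservable events.\<close>

lemma delta_star_projected_empty_iff:
  "delta_star (projected G So) X u = {} \<longleftrightarrow> delta_lang G X (inv_proj G So u) = {}"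
proof (cases u)
  case Nil
  \<comment> \<open>Unobservable moves only enlarge \<open>X\<close>, and they cannot start from the
    empty set, so emptiness is unaffected.\<close>
  have "[] \<in> inv_proj G So []" by (simp add: inv_proj_def proj_def)
  then have "X \<subseteq> delta_lang G X (inv_proj G So [])"
    unfolding delta_lang_def by force
  moreover have "delta_lang G {} (inv_proj G So []) = {}"
    by (simp add: delta_lang_def)
  ultimately show ?thesis using Nil by auto
next
  case (Cons a v)
  then show ?thesis
    using delta_star_projected[of G So X "[a]" v]
    by (simp add: delta_star_Cons Union_delta_projected)
qed

lemma foldl_dtrans_observer:
  "foldl (dtrans (observer G So)) X u = delta_star (projected G So) X u"
  by (simp add: observer_def delta_star_def)

lemma dreachable_observer:
  "dreachable (observer G So) = (\<lambda>u. delta_lang G (initial G) (inv_proj G So u)) ` lists So"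
proof -
  have "foldl (dtrans (observer G So)) (dinitial (observer G So)) u =
      delta_lang G (initial G) (inv_proj G So u)" for u
    \<comment> \<open>The initial state of the observer is the set belonging to the empty
      observation.\<close>
    using delta_star_projected[of G So "initial G" "[]" u]
    by (simp only: foldl_dtrans_observer) (simp add: observer_def)
  then show ?thesis
    by (auto simp: dreachable_def observer_def)
qed

section \<open>Words read in a given number of steps, and runs of the product\<close>

lemma successors_power:
  "(successors A ^^ n) X = (\<Union>u\<in>{u \<in> lists (alphabet A). length u = n}. delta_star A X u)"
proof (induction n arbitrary: X)
  case 0
  have "{u \<in> lists (alphabet A). length u = 0} = {[]}" by auto
  then show ?case by simp
next
  case (Suc n)
  have words: "{u \<in> lists (alphabet A). length u = Suc n} =
      (\<Union>a\<in>alphabet A. (#) a ` {u \<in> lists (alphabet A). length u = n})"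
    by (force simp: length_Suc_conv)
  have "successors A X = (\<Union>a\<in>alphabet A. \<Union>q\<in>X. delta A q a)"
    by (auto simp: successors_def)
  \<comment> \<open>The innermost application of \<open>successors\<close> is split off, since it
    corresponds to the first letter of the word; hence \<open>X\<close> is arbitrary in the
    induction.\<close>
  then have "(successors A ^^ Suc n) X =
      (\<Union>u\<in>{u \<in> lists (alphabet A). length u = n}. \<Union>a\<in>alphabet A.
         delta_star A (\<Union>q\<in>X. delta A q a) u)"
    by (simp only: funpow_Suc_right o_apply Suc.IH delta_star_UN)
  also have "\<dots> = (\<Union>u\<in>{u \<in> lists (alphabet A). length u = Suc n}. delta_star A X u)"
    unfolding words by (auto simp: delta_star_Cons)
  finally show ?case .
qed

text \<open>The second component is deterministic and does not depend on the path chosen in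
  \<open>A\<close>, so the states reached on a word form a product with a singleton.\<close>

lemma delta_star_product:
  "delta_star (product A D Y) {(q, Z)} u = delta_star A {q} u \<times> {foldl (dtrans D) Z u}"
proof (induction u arbitrary: q Z)
  case (Cons a u)
  have "(\<Union>p\<in>{(q, Z)}. delta (product A D Y) p a) = (\<Union>q'\<in>delta A q a. {(q', dtrans D Z a)})"
    by (auto simp: product_def)
  then have "delta_star (product A D Y) {(q, Z)} (a # u) =
      (\<Union>q'\<in>delta A q a. delta_star A {q'} u \<times> {foldl (dtrans D) (dtrans D Z a) u})"
    by (simp only: delta_star_Cons delta_star_UN Cons.IH)
  also have "\<dots> = delta_star A (\<Union>q'\<in>delta A q a. {q'}) u \<times> {foldl (dtrans D) Z (a # u)}"
    by (auto simp: delta_star_UN simp del: UN_singleton)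
  finally show ?case by (simp add: delta_star_Cons)
qed simp

section \<open>Opacity\<close>

lemma k_step_opaque_iff_observations:
  fixes G :: "('q, 'a) nfa" and So :: "'a set"
  defines "X u \<equiv> delta_lang G (initial G) (inv_proj G So u)"
  shows "k_step_opaque G QS QNS So K \<longleftrightarrow>
    (\<forall>u\<in>lists So. \<forall>v\<in>lists So. \<forall>x. enat (length v) \<le> K \<and> x \<in> X u \<inter> QS \<and>
       delta_lang G {x} (inv_proj G So v) \<noteq> {} \<longrightarrow>
       delta_lang G (X u \<inter> QNS) (inv_proj G So v) \<noteq> {})"
    (is "_ \<longleftrightarrow> ?R")
proof -
  \<comment> \<open>Dropping the restriction to \<open>R\<close> only enlarges the set reached, so a
    surviving run makes the word generated.\<close>
  have non_empty: "s @ t \<in> gen_lang G"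
    if "delta_star G (delta_star G (initial G) s \<inter> R) t \<noteq> {}"
      "s \<in> lists (alphabet G)" "t \<in> lists (alphabet G)" for s t R
    using that delta_star_mono[of "delta_star G (initial G) s \<inter> R" "delta_star G (initial G) s" G t]
    by (auto simp: gen_lang_def delta_star_append)
  \<comment> \<open>Stated for arbitrary \<open>R\<close> to serve both sides of the opacity
    condition: \<open>QS\<close> for the premise, \<open>QNS\<close> for the conclusion.\<close>
  have surviving: "delta_lang G (X u \<inter> R) (inv_proj G So v) \<noteq> {} \<longleftrightarrow>
      (\<exists>s t. s @ t \<in> gen_lang G \<and> u = proj So s \<and> v = proj So t \<and>
         delta_star G (delta_star G (initial G) s \<inter> R) t \<noteq> {})" (is "?L \<longleftrightarrow> ?E") for u v R
  proof -
    have "X u \<inter> R = (\<Union>s\<in>inv_proj G So u. delta_star G (initial G) s \<inter> R)"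
      by (auto simp: X_def delta_lang_def)
    then have "delta_lang G (X u \<inter> R) (inv_proj G So v) =
        (\<Union>t\<in>inv_proj G So v. \<Union>s\<in>inv_proj G So u.
           delta_star G (delta_star G (initial G) s \<inter> R) t)"
      by (simp only: delta_lang_def delta_star_UN)
    then have "?L \<longleftrightarrow> (\<exists>s\<in>inv_proj G So u. \<exists>t\<in>inv_proj G So v.
        delta_star G (delta_star G (initial G) s \<inter> R) t \<noteq> {})"
      by blast
    also have "\<dots> \<longleftrightarrow> ?E"
    proof
      assume "\<exists>s\<in>inv_proj G So u. \<exists>t\<in>inv_proj G So v.
        delta_star G (delta_star G (initial G) s \<inter> R) t \<noteq> {}"
      then obtain s t where st: "s \<in> inv_proj G So u" "t \<in> inv_proj G So v"
        "delta_star G (delta_star G (initial G) s \<inter> R) t \<noteq> {}" by blast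
      then show ?E using non_empty[OF st(3)] unfolding inv_proj_def by blast
    next
      assume ?E
      then obtain s t where st: "s @ t \<in> gen_lang G" "u = proj So s" "v = proj So t"
        "delta_star G (delta_star G (initial G) s \<inter> R) t \<noteq> {}" by blast
      then have "s \<in> inv_proj G So u" "t \<in> inv_proj G So v"
        by (auto simp: gen_lang_def inv_proj_def)
      with st(4) show "\<exists>s\<in>inv_proj G So u. \<exists>t\<in>inv_proj G So v.
        delta_star G (delta_star G (initial G) s \<inter> R) t \<noteq> {}" by blast
    qed
    finally show ?thesis .
  qed
  have proj_lists: "proj So w \<in> lists So" for w
    by (auto simp: proj_def)
  \<comment> \<open>The product follows one secret state at a time, whereas the definition of
    opacity starts from a whole set.\<close>
  have elem: "delta_lang G (X u \<inter> QS) (inv_proj G So v) \<noteq> {} \<longleftrightarrow>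
      (\<exists>x\<in>X u \<inter> QS. delta_lang G {x} (inv_proj G So v) \<noteq> {})" for u v
    using delta_lang_UN[of G "\<lambda>x. {x}" "X u \<inter> QS" "inv_proj G So v"] by auto
  have in_lists: "u \<in> lists So" "v \<in> lists So"
    if "delta_lang G (X u \<inter> R) (inv_proj G So v) \<noteq> {}" for u v R
    using that proj_lists unfolding surviving by blast+
  have "k_step_opaque G QS QNS So K \<longleftrightarrow>
      (\<forall>s t. s @ t \<in> gen_lang G \<and> enat (length (proj So t)) \<le> K \<and>
         delta_star G (delta_star G (initial G) s \<inter> QS) t \<noteq> {} \<longrightarrow>
         delta_lang G (X (proj So s) \<inter> QNS) (inv_proj G So (proj So t)) \<noteq> {})"
    unfolding k_step_opaque_def surviving ..
  also have "\<dots> \<longleftrightarrow>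
      (\<forall>u v. enat (length v) \<le> K \<longrightarrow> delta_lang G (X u \<inter> QS) (inv_proj G So v) \<noteq> {} \<longrightarrow>
         delta_lang G (X u \<inter> QNS) (inv_proj G So v) \<noteq> {})"
    unfolding surviving[of _ QS] by blast
  also have "\<dots> \<longleftrightarrow>
      (\<forall>u\<in>lists So. \<forall>v\<in>lists So. enat (length v) \<le> K \<longrightarrow>
         delta_lang G (X u \<inter> QS) (inv_proj G So v) \<noteq> {} \<longrightarrow>
         delta_lang G (X u \<inter> QNS) (inv_proj G So v) \<noteq> {})"
    \<comment> \<open>Sequences not over \<open>So\<close> are observations of no word, so the
      premise fails for them.\<close>
    using in_lists by blast
  also have "\<dots> \<longleftrightarrow> ?R"
    unfolding elem by blast
  finally show ?thesis .
qed

theorem theorem2: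
  fixes G :: "('q, 'a) nfa"
    and So Suo :: "'a set"
    and QS QNS :: "'q set"
    and K :: enat
  assumes "is_des G So Suo"
    and "QS \<subseteq> states G"
    and "QNS \<subseteq> states G"
  shows "k_step_opaque G QS QNS So K \<longleftrightarrow> opacity_algorithm G QS QNS So K = Some True"
proof -
  define X where "X = (\<lambda>u. delta_lang G (initial G) (inv_proj G So u))"
  define PG where "PG = projected G So"
  define D where "D = observer G So"
  define Y where "Y = (\<Union>Z\<in>dreachable D. {(x, Z \<inter> QNS) | x. x \<in> Z \<inter> QS})"
  define C where "C = product PG D Y"
  have nfa: "is_nfa G"
    using assms(1) by (simp add: is_des_def)
  have Y: "Y = (\<Union>u\<in>lists So. \<Union>x\<in>X u \<inter> QS. {(x, X u \<inter> QNS)})"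
    by (auto simp: Y_def D_def dreachable_observer X_def)
  have alph: "alphabet C = So" and init: "initial C = Y"
    by (auto simp: C_def product_def PG_def projected_def D_def observer_def)
  define S where "S = states G \<times> Pow (states G)"
  have "finite S"
    using nfa by (auto simp: S_def is_nfa_def)
  moreover have "initial C \<subseteq> S"
    using assms(2,3) by (auto simp: init Y S_def)
  moreover have "successors C S \<subseteq> S"
  proof -
    have trans: "(\<Union>q\<in>Z. delta PG q a) \<subseteq> states G" if "Z \<subseteq> states G" for Z a
      using delta_lang_inv_proj_subset_states[OF nfa that]
      by (simp add: PG_def Union_delta_projected)
    have delta: "delta PG q a \<subseteq> states G" if "q \<in> states G" for q a
      using that trans[of "{q}" a] by simp
    have dtrans: "dtrans D Z a \<subseteq> states G" if "Z \<subseteq> states G" for Z a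
      using trans[OF that] by (simp add: D_def PG_def observer_def)
    have "delta C (q, Z) a \<subseteq> S" if "q \<in> states G" "Z \<subseteq> states G" for q Z a
      using delta[OF that(1)] dtrans[OF that(2)] unfolding C_def product_def S_def by auto
    then show ?thesis
      unfolding successors_def S_def by blast
  qed
  ultimately have "bfs C K = Some (reach_within C K)"
    by (rule bfs_eq_reach_within)
  then have "opacity_algorithm G QS QNS So K = Some True \<longleftrightarrow>
      \<not> (\<exists>q. (q, {}) \<in> reach_within C K)"
    by (simp add: opacity_algorithm_def Let_def C_def PG_def D_def Y_def)
  also have "reach_within C K =
      (\<Union>v\<in>{v \<in> lists So. enat (length v) \<le> K}. delta_star C Y v)"
    by (auto simp: reach_within_def successors_power alph init)
  also have "\<dots> = (\<Union>v\<in>{v \<in> lists So. enat (length v) \<le> K}. \<Union>u\<in>lists So. \<Union>x\<in>X u \<inter> QS.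
      delta_star PG {x} v \<times> {delta_star PG (X u \<inter> QNS) v})"
    by (simp only: Y delta_star_UN C_def delta_star_product D_def foldl_dtrans_observer PG_def)
  \<comment> \<open>A pair \<open>(q, {})\<close> lies in one of these products exactly when the
    first factor is nonempty and the single element of the second is \<open>{}\<close>.\<close>
  also have "\<not> (\<exists>q. (q, {}) \<in> \<dots>) \<longleftrightarrow>
    (\<forall>u\<in>lists So. \<forall>v\<in>lists So. \<forall>x. enat (length v) \<le> K \<and> x \<in> X u \<inter> QS \<and>
       delta_star PG {x} v \<noteq> {} \<longrightarrow> delta_star PG (X u \<inter> QNS) v \<noteq> {})"
    by (simp only: UN_iff mem_Times_iff fst_conv snd_conv singleton_iff eq_commute[of "{}"]
        mem_Collect_eq) blast
  also have "\<dots> \<longleftrightarrow> k_step_opaque G QS QNS So K"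
    \<comment> \<open>Both conditions only ask whether a set is empty, so runs of the projected
      automaton may be exchanged for runs of \<open>G\<close>.\<close>
    unfolding PG_def delta_star_projected_empty_iff k_step_opaque_iff_observations X_def ..
  finally show ?thesis ..
qed

end
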